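(* Let $K$ be a compact Hausdorff space, $\varphi\colon K\to K$ a continuous map, and $T_\varphi$ the Koopman operator on $\mathrm{C}(K)$. Then the fixed space $\operatorname{fix}T_\varphi$ is one-dimensional (over $\mathbb{C}$) if and only if $(K;\varphi)$ is topologically ergodic, i.e. there exist $x\in K$ and an ordinal number $\gamma$ such that $K=\operatorname{sorb}_\gamma(x)$.
   Context: $\mathrm{C}(K)$ is the $C^*$-algebra of continuous complex-valued functions on $K$; the Koopman operator is $T_\varphi f:=f\circ\varphi$ for $f\in\mathrm{C}(K)$, and $\operatorname{fix}T_\varphi:=\{f\in\mathrm{C}(K): T_\varphi f=f\}$. $\mathcal{U}(x)$ denotes the neighborhood filter of $x$ (neighborhoods need not be open). For a family $(K_x)_{x\in K}$ of subsets of $K$ with $x\in K_x$ for all $x$, the equivalence relation generated by $(K_x)_{x\in K}$ is: $x\sim y$ iff there are $k\in\mathbb{N}$ and $x_1,\dots,x_k\in K$ with $x_1=x$, $x_k=y$ and $K_{x_i}\cap K_{x_{i+1}}\neq\emptyset$ for $i=1,\dots,k-1$. For every ordinal $\gamma$ and $x\in K$ define by transfinite recursion the approximating orbit $\operatorname{aorb}_\gamma(x)\subseteq K$, the equivalence relation $\sim_\gamma$ on $K$ and the superorbit $\operatorname{sorb}_\gamma(x)\subseteq K$ as follows. Base case: $\operatorname{aorb}_0(x):=\bigcap\{U: U\in\mathcal{U}(x)\text{ closed},\ \varphi(U)\subseteq U\}$. Successor case $\gamma=\beta+1$: $\operatorname{aorb}_{\gamma}(x):=\bigcap\{\overline{U}^{\operatorname{sorb}_{\beta}}: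 U\in\mathcal{U}(x)\text{ open},\ \operatorname{sorb}_{\beta}(U)\subseteq U\}$, where $\operatorname{sorb}_\beta(S):=\bigcup_{y\in S}\operatorname{sorb}_\beta(y)$ for $S\subseteq K$ and $\overline{U}^{\operatorname{sorb}_\beta}:=\bigcap\{F: F\in\mathcal{U}(x)\text{ closed},\ U\subseteq F,\ \operatorname{sorb}_\beta(F)\subseteq F\}$. Limit case ($\gamma\neq0$ a limit ordinal): $\operatorname{aorb}_\gamma(x):=\bigcup_{\beta<\gamma}\operatorname{sorb}_\beta(x)$. In all cases $\sim_\gamma$ is the equivalence relation generated by $(\operatorname{aorb}_\gamma(x))_{x\in K}$, $\pi_\gamma\colon K\to K/{\sim_\gamma}$ is the canonical projection, and $\operatorname{sorb}_\gamma(x):=\pi_\gamma^{-1}([x])=\bigcup_{y\sim_\gamma x}\operatorname{aorb}_\gamma(y)$, i.e. the $\sim_\gamma$-equivalence class of $x$ as a subset of $K$. *)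

theory Defs
  imports "HOL-Analysis.Analysis" "HOL-Library.Function_Algebras"
begin

section \<open>The fixed space of the Koopman operator\<close>

text \<open>Complex-valued functions with pointwise operations; the space \<open>C(K)\<close> is a subset of it.\<close>

interpretation cfun: vector_space "\<lambda>(c::complex) (f :: 'a \<Rightarrow> complex) x. c * f x"
  by unfold_locales (auto simp: fun_eq_iff algebra_simps)

definition continuous_functions :: "('a::topological_space \<Rightarrow> complex) set" where
  "continuous_functions = {f. continuous_on UNIV f}"

definition koopman :: "('a \<Rightarrow> 'a) \<Rightarrow> ('a \<Rightarrow> complex) \<Rightarrow> 'a \<Rightarrow> complex" where
  "koopman \<phi> f = f \<circ> \<phi>"

definition fixed_space :: "('a::topological_space \<Rightarrow> 'a) \<Rightarrow> ('a \<Rightarrow> complex) set" where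
  "fixed_space \<phi> = {f \<in> continuous_functions. koopman \<phi> f = f}"

lemma subspace_fixed_space: "cfun.subspace (fixed_space \<phi>)"
  by (auto simp: cfun.subspace_def fixed_space_def continuous_functions_def koopman_def
      fun_eq_iff plus_fun_def zero_fun_def intro!: continuous_intros)


section \<open>Approximating orbits and superorbits\<close>

definition nbhd :: "'a::topological_space set \<Rightarrow> 'a \<Rightarrow> bool" where
  "nbhd U x \<longleftrightarrow> eventually (\<lambda>y. y \<in> U) (nhds x)"

text \<open>The class of \<open>x\<close> under the equivalence relation generated by a family \<open>A\<close> of sets: all
  end points of finite chains \<open>x = x\<^sub>1, \<dots>, x\<^sub>k\<close> along which consecutive sets meet.\<close>

definition gen_class :: "('a \<Rightarrow> 'a set) \<Rightarrow> 'a \<Rightarrow> 'a set" where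
  "gen_class A x = {y. (\<lambda>u v. A u \<inter> A v \<noteq> {})\<^sup>*\<^sup>* x y}"

definition aorb_zero :: "('a::topological_space \<Rightarrow> 'a) \<Rightarrow> 'a \<Rightarrow> 'a set" where
  "aorb_zero \<phi> x = \<Inter>{U. nbhd U x \<and> closed U \<and> \<phi> ` U \<subseteq> U}"

definition sat_closure :: "('a::topological_space \<Rightarrow> 'a set) \<Rightarrow> 'a \<Rightarrow> 'a set \<Rightarrow> 'a set" where
  "sat_closure S x U = \<Inter>{F. nbhd F x \<and> closed F \<and> U \<subseteq> F \<and> (\<Union>y\<in>F. S y) \<subseteq> F}"

definition aorb_succ :: "('a::topological_space \<Rightarrow> 'a set) \<Rightarrow> 'a \<Rightarrow> 'a set" where
  "aorb_succ S x = \<Inter>{sat_closure S x U |U. nbhd U x \<and> open U \<and> (\<Union>y\<in>U. S y) \<subseteq> U}"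

text \<open>An ordinal is represented by an element \<open>\<gamma>\<close> of the field of a well-order \<open>r\<close>; it stands for
  the order type of the set of strict predecessors of \<open>\<gamma>\<close>.\<close>

definition imm_pred :: "'o rel \<Rightarrow> 'o \<Rightarrow> 'o \<Rightarrow> bool" where
  "imm_pred r \<beta> \<gamma> \<longleftrightarrow> \<beta> \<in> underS r \<gamma> \<and> underS r \<gamma> \<subseteq> under r \<beta>"

definition aorb_step ::
    "('a::topological_space \<Rightarrow> 'a) \<Rightarrow> 'o rel \<Rightarrow> ('o \<Rightarrow> 'a \<Rightarrow> 'a set) \<Rightarrow> 'o \<Rightarrow> 'a \<Rightarrow> 'a set" where
  "aorb_step \<phi> r S \<gamma> x =
    (if underS r \<gamma> = {} then aorb_zero \<phi> x
     else if \<exists>\<beta>. imm_pred r \<beta> \<gamma> then aorb_succ (S (THE \<beta>. imm_pred r \<beta> \<gamma>)) x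
     else (\<Union>\<beta>\<in>underS r \<gamma>. S \<beta> x))"

definition sorb :: "('a::topological_space \<Rightarrow> 'a) \<Rightarrow> 'o rel \<Rightarrow> 'o \<Rightarrow> 'a \<Rightarrow> 'a set" where
  "sorb \<phi> r = wfrec (r - Id) (\<lambda>S \<gamma>. gen_class (aorb_step \<phi> r S \<gamma>))"

definition aorb :: "('a::topological_space \<Rightarrow> 'a) \<Rightarrow> 'o rel \<Rightarrow> 'o \<Rightarrow> 'a \<Rightarrow> 'a set" where
  "aorb \<phi> r = aorb_step \<phi> r (sorb \<phi> r)"

text \<open>One cannot quantify over well-orders of all types inside a formula. It is enough to use
  well-orders on the type of relations on \<open>K\<close>: there are no more distinct relations \<open>\<sim>\<^sub>\<gamma>\<close> than
  that. The lemma \<open>topologically_ergodicI\<close> below shows that ordinals represented in any other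
  type do not give more.\<close>

definition topologically_ergodic :: "('a::topological_space \<Rightarrow> 'a) \<Rightarrow> bool" where
  "topologically_ergodic \<phi> \<longleftrightarrow>
    (\<exists>(r :: 'a rel rel) \<gamma> x. Well_order r \<and> \<gamma> \<in> Field r \<and> sorb \<phi> r \<gamma> x = UNIV)"


subsection \<open>The recursion equations\<close>

lemma underS_iff: "\<beta> \<in> underS r \<gamma> \<longleftrightarrow> (\<beta>, \<gamma>) \<in> r - Id"
  by (auto simp: underS_def)

lemma imm_pred_unique:
  assumes "Well_order r" "imm_pred r \<beta> \<gamma>" "imm_pred r \<beta>' \<gamma>"
  shows "\<beta>' = \<beta>"
proof -
  have "antisym r" using assms(1) by (simp add: order_on_defs)
  moreover have "(\<beta>, \<beta>') \<in> r" "(\<beta>', \<beta>) \<in> r"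
    using assms(2,3) by (auto simp: imm_pred_def under_def)
  ultimately show ?thesis by (simp add: antisym_def)
qed

lemma the_imm_pred:
  assumes "Well_order r" "imm_pred r \<beta> \<gamma>"
  shows "(THE \<beta>. imm_pred r \<beta> \<gamma>) = \<beta>"
  using imm_pred_unique[OF assms(1)] assms(2) by (intro the_equality) auto

lemma aorb_step_cong:
  assumes "Well_order r" "\<And>\<beta>. \<beta> \<in> underS r \<gamma> \<Longrightarrow> S \<beta> = S' \<beta>"
  shows "aorb_step \<phi> r S \<gamma> = aorb_step \<phi> r S' \<gamma>"
proof (rule ext)
  fix x
  show "aorb_step \<phi> r S \<gamma> x = aorb_step \<phi> r S' \<gamma> x"
  proof (cases "\<exists>\<beta>. imm_pred r \<beta> \<gamma>")
    case True
    then obtain \<beta> where b: "imm_pred r \<beta> \<gamma>" by blast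
    then have "S \<beta> = S' \<beta>" using assms(2) by (simp add: imm_pred_def)
    then show ?thesis using b
      by (auto simp: aorb_step_def the_imm_pred[OF assms(1) b])
  next
    case False
    then show ?thesis using assms(2) by (simp add: aorb_step_def)
  qed
qed

lemma sorb_eq:
  assumes "Well_order r"
  shows "sorb \<phi> r \<gamma> = gen_class (aorb \<phi> r \<gamma>)"
proof -
  have wf: "wf (r - Id)" using assms by (simp add: well_order_on_def)
  have "aorb_step \<phi> r (cut (sorb \<phi> r) (r - Id) \<gamma>) \<gamma> = aorb_step \<phi> r (sorb \<phi> r) \<gamma>"
    by (rule aorb_step_cong[OF assms]) (simp add: underS_iff cut_apply)
  then show ?thesis
    using wfrec[OF wf, of "\<lambda>S \<gamma>. gen_class (aorb_step \<phi> r S \<gamma>)" \<gamma>]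
    by (simp add: sorb_def aorb_def)
qed

lemma aorb_zero_eq: "underS r \<gamma> = {} \<Longrightarrow> aorb \<phi> r \<gamma> = aorb_zero \<phi>"
  by (auto simp: aorb_def aorb_step_def fun_eq_iff)

lemma aorb_succ_eq:
  assumes "Well_order r" "imm_pred r \<beta> \<gamma>"
  shows "aorb \<phi> r \<gamma> = aorb_succ (sorb \<phi> r \<beta>)"
  using assms(2) the_imm_pred[OF assms]
  by (auto simp: aorb_def aorb_step_def fun_eq_iff imm_pred_def)

lemma aorb_limit_eq:
  assumes "underS r \<gamma> \<noteq> {}" "\<nexists>\<beta>. imm_pred r \<beta> \<gamma>"
  shows "aorb \<phi> r \<gamma> x = (\<Union>\<beta>\<in>underS r \<gamma>. sorb \<phi> r \<beta> x)"
  using assms by (simp add: aorb_def aorb_step_def)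


subsection \<open>Independence of the type carrying the ordinals\<close>

lemma gen_class_refl: "x \<in> gen_class A x"
  by (simp add: gen_class_def)

lemma subset_gen_class:
  assumes "\<And>x. x \<in> A x"
  shows "A x \<subseteq> gen_class A x"
  using assms by (auto simp: gen_class_def intro!: r_into_rtranclp)

lemma gen_class_idem: "gen_class (gen_class A) = gen_class A"
proof -
  let ?R = "\<lambda>u v. A u \<inter> A v \<noteq> {}"
  have "symp ?R" by (auto intro: sympI)
  then have sym: "symp ?R\<^sup>*\<^sup>*" by (rule symp_rtranclp)
  have "?R\<^sup>*\<^sup>* u v" if "gen_class A u \<inter> gen_class A v \<noteq> {}" for u v
    using that sym by (auto simp: gen_class_def dest: sympD intro: rtranclp_trans)
  then have "(\<lambda>u v. gen_class A u \<inter> gen_class A v \<noteq> {}) \<le> ?R\<^sup>*\<^sup>*"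
    by (intro predicate2I)
  from rtranclp_mono[OF this] have "gen_class (gen_class A) x \<subseteq> gen_class A x" for x
    unfolding gen_class_def[of "gen_class A"] gen_class_def[of A x] by auto
  moreover have "gen_class A x \<subseteq> gen_class (gen_class A) x" for x
    by (rule subset_gen_class) (rule gen_class_refl)
  ultimately show ?thesis by (auto simp: fun_eq_iff)
qed

lemma subset_aorb_succ:
  assumes "x \<in> S x"
  shows "S x \<subseteq> aorb_succ S x"
  unfolding aorb_succ_def sat_closure_def nbhd_def by (auto dest: eventually_nhds_x_imp_x)

context
  fixes r :: "'o rel" and \<phi> :: "'a::topological_space \<Rightarrow> 'a"
  assumes wo: "Well_order r"
begin

private abbreviation "S \<equiv> sorb \<phi> r"

private lemma ordfacts: "wf (r - Id)" "trans r" "antisym r" "Total r" "Refl r"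
  using wo by (auto simp: order_on_defs)

private lemma sorb_refl: "x \<in> S \<gamma> x"
  by (simp add: sorb_eq[OF wo] gen_class_refl)

private lemma aorb_refl: "x \<in> aorb \<phi> r \<gamma> x"
proof -
  consider "underS r \<gamma> = {}" | \<beta> where "imm_pred r \<beta> \<gamma>"
    | "underS r \<gamma> \<noteq> {}" "\<nexists>\<beta>. imm_pred r \<beta> \<gamma>" by blast
  then show ?thesis
  proof cases
    case 1
    then show ?thesis
      by (auto simp: aorb_zero_eq aorb_zero_def nbhd_def dest: eventually_nhds_x_imp_x)
  next
    case (2 \<beta>)
    then show ?thesis using subset_aorb_succ[of x "S \<beta>", OF sorb_refl] sorb_refl[of x \<beta>]
      by (auto simp: aorb_succ_eq[OF wo])
  next
    case 3
    then show ?thesis using sorb_refl by (auto simp: aorb_limit_eq)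
  qed
qed

private lemma aorb_sub_sorb: "aorb \<phi> r \<gamma> x \<subseteq> S \<gamma> x"
  unfolding sorb_eq[OF wo] by (rule subset_gen_class) (rule aorb_refl)

private lemma sorb_mono_strict: "\<beta> \<in> underS r \<gamma> \<Longrightarrow> S \<beta> x \<subseteq> S \<gamma> x"
proof (induction \<gamma> arbitrary: \<beta> rule: wf_induct_rule[OF ordfacts(1)])
  case (1 \<gamma>)
  show ?case
  proof (cases "\<exists>\<delta>. imm_pred r \<delta> \<gamma>")
    case True
    then obtain \<delta> where d: "imm_pred r \<delta> \<gamma>" by blast
    have "S \<delta> x \<subseteq> S \<gamma> x"
      using subset_aorb_succ[of x "S \<delta>", OF sorb_refl] aorb_sub_sorb[of \<gamma> x] aorb_succ_eq[OF wo d, of \<phi>]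
      by auto
    moreover have "S \<beta> x \<subseteq> S \<delta> x"
    proof (cases "\<beta> = \<delta>")
      case False
      then have "\<beta> \<in> underS r \<delta>"
        using d 1(2) by (auto simp: imm_pred_def under_def underS_def)
      then show ?thesis using d 1(1)[of \<delta> \<beta>] by (auto simp: imm_pred_def underS_iff)
    qed simp
    ultimately show ?thesis by blast
  next
    case False
    have "S \<beta> x \<subseteq> aorb \<phi> r \<gamma> x"
      using 1(2) False by (subst aorb_limit_eq) auto
    then show ?thesis using aorb_sub_sorb by blast
  qed
qed

private lemma sorb_mono: "(\<beta>, \<gamma>) \<in> r \<Longrightarrow> S \<beta> x \<subseteq> S \<gamma> x"
  using sorb_mono_strict[of \<beta> \<gamma>] by (cases "\<beta> = \<gamma>") (auto simp: underS_iff)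

private lemma less_or_ge:
  "\<beta> \<in> Field r \<Longrightarrow> \<gamma> \<in> Field r \<Longrightarrow> \<beta> \<in> underS r \<gamma> \<or> (\<gamma>, \<beta>) \<in> r"
  using ordfacts(4,5) by (cases "\<beta> = \<gamma>") (auto simp: underS_def total_on_def refl_on_def)

private lemma imm_pred_exists:
  assumes "\<beta> \<in> underS r \<delta>"
  obtains \<sigma> where "imm_pred r \<beta> \<sigma>" "(\<sigma>, \<delta>) \<in> r"
proof -
  obtain \<sigma> where s: "\<beta> \<in> underS r \<sigma>" and min: "\<And>\<tau>. (\<tau>, \<sigma>) \<in> r - Id \<Longrightarrow> \<beta> \<notin> underS r \<tau>"
    using wfE_min[OF ordfacts(1), of \<delta> "{\<sigma>. \<beta> \<in> underS r \<sigma>}"] assms by auto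
  have fld: "\<beta> \<in> Field r" "\<sigma> \<in> Field r" "\<delta> \<in> Field r"
    using s assms by (auto simp: underS_def Field_def)
  have "imm_pred r \<beta> \<sigma>"
    using s min less_or_ge[OF fld(1)] by (auto simp: imm_pred_def underS_def under_def Field_def)
  moreover have "(\<sigma>, \<delta>) \<in> r"
    using less_or_ge[OF fld(3,2)] min[of \<delta>] assms by (auto simp: underS_iff)
  ultimately show thesis using that by blast
qed

private lemma sorb_stable:
  assumes "\<beta> \<in> underS r \<delta>" "S \<beta> = S \<delta>" "(\<beta>, \<epsilon>) \<in> r"
  shows "S \<epsilon> = S \<beta>"
  using assms(3)
proof (induction \<epsilon> rule: wf_induct_rule[OF ordfacts(1)])
  case (1 \<epsilon>)
  obtain \<sigma> where s: "imm_pred r \<beta> \<sigma>" "(\<sigma>, \<delta>) \<in> r" using imm_pred_exists[OF assms(1)] .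
  have "S \<sigma> = S \<beta>"
  proof (rule ext)
    fix x
    show "S \<sigma> x = S \<beta> x"
      using sorb_mono[OF s(2), of x] sorb_mono_strict[of \<beta> \<sigma> x] s(1) assms(2)
      by (auto simp: imm_pred_def)
  qed
  then have step: "gen_class (aorb_succ (S \<beta>)) = S \<beta>"
    using sorb_eq[OF wo, of \<phi> \<sigma>] aorb_succ_eq[OF wo s(1), of \<phi>] by simp
  show ?case
  proof (cases "\<beta> = \<epsilon>")
    case False
    then have b: "\<beta> \<in> underS r \<epsilon>" using 1(2) by (auto simp: underS_def)
    show ?thesis
    proof (cases "\<exists>\<eta>. imm_pred r \<eta> \<epsilon>")
      case True
      then obtain \<eta> where e: "imm_pred r \<eta> \<epsilon>" by blast
      then have "(\<beta>, \<eta>) \<in> r" "(\<eta>, \<epsilon>) \<in> r - Id"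
        using b by (auto simp: imm_pred_def under_def underS_iff)
      then have "S \<eta> = S \<beta>" using 1(1) by blast
      then show ?thesis using step sorb_eq[OF wo, of \<phi> \<epsilon>] aorb_succ_eq[OF wo e, of \<phi>] by simp
    next
      case False
      have "aorb \<phi> r \<epsilon> x = S \<beta> x" for x
      proof -
        have "S \<eta> x \<subseteq> S \<beta> x" if "\<eta> \<in> underS r \<epsilon>" for \<eta>
        proof -
          have "\<eta> \<in> Field r" "\<beta> \<in> Field r" using that b by (auto simp: underS_def Field_def)
          then consider "\<eta> \<in> underS r \<beta>" | "(\<beta>, \<eta>) \<in> r" using less_or_ge by blast
          then show ?thesis
          proof cases
            case 1
            then show ?thesis by (rule sorb_mono_strict)
          next
            case 2
            then show ?thesis using "1.IH"[of \<eta>] that by (simp add: underS_iff)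
          qed
        qed
        then show ?thesis using b False by (subst aorb_limit_eq) auto
      qed
      then have "aorb \<phi> r \<epsilon> = S \<beta>" by (rule ext)
      then show ?thesis
        using sorb_eq[OF wo, of \<phi> \<epsilon>] sorb_eq[OF wo, of \<phi> \<beta>] gen_class_idem by metis
    qed
  qed simp
qed

private lemma transfer:
  fixes h :: "'o \<Rightarrow> 'p"
  assumes D: "D = under r \<gamma>" and inj: "inj_on h D"
    and r': "r' = {(h a, h b) |a b. (a, b) \<in> r \<and> a \<in> D \<and> b \<in> D}" and wo': "Well_order r'"
  shows "\<beta> \<in> D \<Longrightarrow> sorb \<phi> r' (h \<beta>) = S \<beta>"
proof (induction \<beta> rule: wf_induct_rule[OF ordfacts(1)])
  case (1 \<beta>)
  have down: "a \<in> D" if "(a, b) \<in> r" "b \<in> D" for a b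
    using that ordfacts(2) by (auto simp: D under_def dest: transD)
  have under': "under r' (h b) = h ` under r b" if "b \<in> D" for b
    using that down inj by (auto simp: r' under_def dest: inj_onD)
  have underS': "underS r' (h b) = h ` underS r b" if "b \<in> D" for b
    using that down inj by (auto simp: r' underS_def dest: inj_onD)
  have subD: "under r b \<subseteq> D" "underS r b \<subseteq> D" if "b \<in> D" for b
    using that down by (auto simp: under_def underS_def)
  have IH: "sorb \<phi> r' (h \<alpha>) = S \<alpha>" if "\<alpha> \<in> underS r \<beta>" for \<alpha>
    using 1(1)[of \<alpha>] that subD(2)[OF 1(2)] by (auto simp: underS_iff)
  have imm: "imm_pred r' (h \<alpha>) (h \<beta>) \<longleftrightarrow> imm_pred r \<alpha> \<beta>" if "\<alpha> \<in> D" for \<alpha>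
    unfolding imm_pred_def under'[OF that] underS'[OF 1(2)]
    using inj_on_image_mem_iff[OF inj that subD(2)[OF 1(2)]]
      inj_on_image_subset_iff[OF inj subD(2)[OF 1(2)] subD(1)[OF that]] by simp
  consider "underS r \<beta> = {}" | \<alpha> where "imm_pred r \<alpha> \<beta>"
    | "underS r \<beta> \<noteq> {}" "\<nexists>\<alpha>. imm_pred r \<alpha> \<beta>" by blast
  then have "aorb \<phi> r' (h \<beta>) = aorb \<phi> r \<beta>"
  proof cases
    case 1
    then show ?thesis using underS'[OF \<open>\<beta> \<in> D\<close>] by (simp add: aorb_zero_eq)
  next
    case (2 \<alpha>)
    then have a: "\<alpha> \<in> underS r \<beta>" by (simp add: imm_pred_def)
    then have "imm_pred r' (h \<alpha>) (h \<beta>)" using imm 2 subD[OF \<open>\<beta> \<in> D\<close>] by blast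
    from aorb_succ_eq[OF wo' this, of \<phi>] aorb_succ_eq[OF wo 2, of \<phi>] IH[OF a]
    show ?thesis by simp
  next
    case 3
    have ne: "\<nexists>a. imm_pred r' a (h \<beta>)"
    proof
      assume "\<exists>a. imm_pred r' a (h \<beta>)"
      then obtain a where a: "imm_pred r' a (h \<beta>)" by blast
      then obtain \<alpha> where "a = h \<alpha>" "\<alpha> \<in> underS r \<beta>"
        unfolding imm_pred_def underS'[OF \<open>\<beta> \<in> D\<close>] by blast
      then show False using a imm 3(2) subD[OF \<open>\<beta> \<in> D\<close>] by blast
    qed
    have "aorb \<phi> r' (h \<beta>) x = aorb \<phi> r \<beta> x" for x
      using aorb_limit_eq[OF 3, of \<phi> x] aorb_limit_eq[OF _ ne, of \<phi> x] underS'[OF \<open>\<beta> \<in> D\<close>] 3(1) IH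
      by simp
    then show ?thesis by (rule ext)
  qed
  then show ?case by (simp add: sorb_eq[OF wo] sorb_eq[OF wo'])
qed

text \<open>Here \<open>'o\<close> is arbitrary.\<close>

lemma topologically_ergodicI:
  assumes "\<gamma> \<in> Field r" "sorb \<phi> r \<gamma> x = UNIV"
  shows "topologically_ergodic \<phi>"
proof -
  obtain \<delta> where d: "S \<delta> = S \<gamma>" "\<delta> \<in> Field r"
    and min: "\<And>\<beta>. (\<beta>, \<delta>) \<in> r - Id \<Longrightarrow> \<not> (S \<beta> = S \<gamma> \<and> \<beta> \<in> Field r)"
    using wfE_min[OF ordfacts(1), of \<gamma> "{\<delta>. S \<delta> = S \<gamma> \<and> \<delta> \<in> Field r}"] assms(1) by auto
  define D where "D = under r \<delta>"
  define h where "h \<beta> = {(x, y). y \<in> S \<beta> x}" for \<beta>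
  have h_eq: "h \<beta> = h \<beta>' \<longleftrightarrow> S \<beta> = S \<beta>'" for \<beta> \<beta>'
    by (auto simp: h_def fun_eq_iff set_eq_iff)
  have D_fld: "D \<subseteq> Field r" by (auto simp: D_def under_def Field_def)
  have ne: "S \<beta> \<noteq> S \<beta>'" if "\<beta> \<in> underS r \<beta>'" "\<beta>' \<in> D" for \<beta> \<beta>'
  proof
    assume eq: "S \<beta> = S \<beta>'"
    have "(\<beta>, \<delta>) \<in> r" "\<beta> \<noteq> \<delta>"
      using that ordfacts(2,3) by (auto simp: D_def under_def underS_def antisym_def dest: transD)
    then show False
      using sorb_stable[OF that(1) eq, of \<delta>] d(1) min[of \<beta>] by (auto simp: Field_def)
  qed
  have inj: "inj_on h D"
  proof (rule inj_onI)
    fix a b assume ab: "a \<in> D" "b \<in> D" "h a = h b"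
    then have "a \<notin> underS r b" "b \<notin> underS r a" using ne[of a b] ne[of b a] h_eq by auto
    then show "a = b"
      using less_or_ge[of a b] less_or_ge[of b a] ab(1,2) D_fld by (auto simp: underS_def)
  qed
  define r' where "r' = dir_image (Restr r D) h"
  have r'_eq: "r' = {(h a, h b) |a b. (a, b) \<in> r \<and> a \<in> D \<and> b \<in> D}"
    by (auto simp: r'_def dir_image_def)
  have "Field (Restr r D) \<subseteq> D" by (auto simp: Field_def)
  then have wo': "Well_order r'"
    unfolding r'_def
    by (intro Well_order_dir_image Well_order_Restr[OF wo] inj_on_subset[OF inj])
  have dD: "\<delta> \<in> D" using d(2) ordfacts(5) by (auto simp: D_def under_def refl_on_def)
  then have "(\<delta>, \<delta>) \<in> r" by (simp add: D_def under_def)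
  then have "(h \<delta>, h \<delta>) \<in> r'" using dD by (auto simp: r'_eq)
  then have "h \<delta> \<in> Field r'" by (auto simp: Field_def)
  moreover have "sorb \<phi> r' (h \<delta>) x = UNIV"
    using transfer[OF D_def inj r'_eq wo' dD] d(1) assms(2) by simp
  ultimately show ?thesis using wo' unfolding topologically_ergodic_def by blast
qed

end

end

theory Submission
  imports Defs
begin

text \<open>
  Once the superorbits have stopped growing, they are the classes of the relation ``no fixed
  function of the Koopman operator separates \<open>x\<close> and \<open>y\<close>''. One inclusion holds at every
  stage and gives one direction, and the other inclusion gives the other direction.

  If \<open>f\<close> is continuous and \<open>f \<circ> \<phi> = f\<close>, then the preimages under \<open>f\<close> of open and closed balls
  around \<open>f x\<close> are among the neighbourhoods that bound the approximating orbits at the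
  zero and the successor stages. Hence \<open>f\<close> is constant on all of these and, by transfinite induction, on all superorbits
  (\<open>invariant_constant_on_sorb\<close>). If one superorbit is all of \<open>K\<close>, then only the constants are
  fixed.

  For the converse, the superorbits cannot be distinct at every stage of a well-order that is
  longer than the set of relations on \<open>K\<close>, and as they increase, they agree at some
  stage with the next one (\<open>sorb_stabilizes\<close>). At such a stage the successor step adds nothing,
  which says precisely that any two classes have disjoint saturated open neighbourhoods
  (\<open>stable_class_separated\<close>). So the quotient of \<open>K\<close> by the superorbits is compact
  Hausdorff. Since \<open>x\<close> and \<open>\<phi> x\<close> always have the same superorbit, continuous functions on the
  quotient induce fixed functions on \<open>K\<close>. If only constants are fixed, Urysohn's lemma leaves room for
  only one class.
\<close>

section \<open>Generated equivalence relations\<close>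

lemma in_gen_class_iff: "y \<in> gen_class A x \<longleftrightarrow> gen_class A y = gen_class A x"
proof
  assume y: "y \<in> gen_class A x"
  let ?R = "(\<lambda>u v. A u \<inter> A v \<noteq> {})\<^sup>*\<^sup>*"
  have "symp ?R"
    by (intro symp_rtranclp sympI) auto
  then have "?R x y" "?R y x"
    using y by (auto simp: gen_class_def dest: sympD)
  then show "gen_class A y = gen_class A x"
    by (auto simp: gen_class_def intro: rtranclp_trans)
next
  assume "gen_class A y = gen_class A x"
  then show "y \<in> gen_class A x"
    using gen_class_refl[of y A] by simp
qed

lemma constant_on_gen_class:
  assumes const: "\<And>u v. v \<in> A u \<Longrightarrow> f v = f u" and y: "y \<in> gen_class A x"
  shows "f y = f x"
proof -
  have "(\<lambda>u v. A u \<inter> A v \<noteq> {})\<^sup>*\<^sup>* x y"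
    using y by (simp add: gen_class_def)
  then show ?thesis
  proof (induction rule: rtranclp_induct)
    case (step u v)
    then obtain w where "w \<in> A u" "w \<in> A v" by blast
    then show ?case using const step.IH by metis
  qed simp
qed

section \<open>Invariant functions are constant on superorbits\<close>

text \<open>
  The preimage of a closed ball around \<open>f x\<close> is one of the closed invariant neighbourhoods of
  \<open>x\<close> that are intersected, and its radius is arbitrary.
\<close>
lemma constant_on_aorb_zero:
  fixes f :: "'a::topological_space \<Rightarrow> 'b::metric_space"
  assumes cont: "continuous_on UNIV f" and inv: "f \<circ> \<phi> = f" and y: "y \<in> aorb_zero \<phi> x"
  shows "f y = f x"
proof -
  have "dist (f x) (f y) \<le> e" if e: "e > 0" for e
  proof -
    let ?F = "f -` cball (f x) e"
    have "open (f -` ball (f x) e)"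
      using cont by (simp add: open_vimage)
    then have "nbhd ?F x"
      using e unfolding nbhd_def eventually_nhds
      by (intro exI[of _ "f -` ball (f x) e"]) auto
    moreover have "closed ?F"
      using cont by (simp add: closed_vimage)
    moreover have "\<phi> ` ?F \<subseteq> ?F"
      using inv by (auto simp: fun_eq_iff)
    ultimately show ?thesis
      using y by (auto simp: aorb_zero_def)
  qed
  then show ?thesis
    using zero_less_dist_iff[of "f x" "f y"] dense[of 0 "dist (f x) (f y)"]
    by (metis not_less)
qed

text \<open>
  If \<open>f\<close> is constant on the classes of the previous stage, then the preimages of the open and the
  closed ball of the same radius are both saturated, so the second one contains the saturated
  closure of the first one.
\<close>
lemma constant_on_aorb_succ:
  fixes f :: "'a::topological_space \<Rightarrow> 'b::metric_space"
  assumes cont: "continuous_on UNIV f" and const: "\<And>u v. v \<in> S u \<Longrightarrow> f v = f u"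
    and y: "y \<in> aorb_succ S x"
  shows "f y = f x"
proof -
  have "dist (f x) (f y) \<le> e" if e: "e > 0" for e
  proof -
    let ?U = "f -` ball (f x) e" and ?F = "f -` cball (f x) e"
    have U: "open ?U" "nbhd ?U x" "nbhd ?F x"
      using cont e unfolding nbhd_def eventually_nhds
      by (auto simp: open_vimage intro!: exI[of _ "f -` ball (f x) e"])
    have closed: "closed ?F"
      using cont by (simp add: closed_vimage)
    have sat: "(\<Union>u\<in>?U. S u) \<subseteq> ?U" "(\<Union>u\<in>?F. S u) \<subseteq> ?F"
      using const by auto
    have "?U \<subseteq> ?F"
      by auto
    then have "sat_closure S x ?U \<subseteq> ?F"
      unfolding sat_closure_def by (intro Inter_lower CollectI conjI U(3) closed sat(2))
    moreover have "aorb_succ S x \<subseteq> sat_closure S x ?U"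
      unfolding aorb_succ_def by (intro Inter_lower CollectI exI[of _ ?U] conjI refl U(1,2) sat(1))
    ultimately have "y \<in> ?F"
      using y by (meson subsetD)
    then show ?thesis
      by simp
  qed
  then show ?thesis
    using zero_less_dist_iff[of "f x" "f y"] dense[of 0 "dist (f x) (f y)"]
    by (metis not_less)
qed

lemma Well_order_imp_wf: "Well_order r \<Longrightarrow> wf (r - Id)"
  by (simp add: well_order_on_def)

lemma invariant_constant_on_sorb:
  fixes f :: "'a::topological_space \<Rightarrow> 'b::metric_space"
  assumes wo: "Well_order r" and cont: "continuous_on UNIV f" and inv: "f \<circ> \<phi> = f"
  shows "y \<in> sorb \<phi> r \<gamma> x \<Longrightarrow> f y = f x"
proof (induction \<gamma> arbitrary: x y rule: wf_induct_rule[OF Well_order_imp_wf[OF wo]])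
  case (1 \<gamma>)
  have IH: "f v = f u" if "\<beta> \<in> underS r \<gamma>" "v \<in> sorb \<phi> r \<beta> u" for \<beta> u v
    using that by (intro "1.IH"[of \<beta> v u]) (simp_all add: underS_iff)
  have "f v = f u" if v: "v \<in> aorb \<phi> r \<gamma> u" for u v
  proof -
    consider "underS r \<gamma> = {}" | \<beta> where "imm_pred r \<beta> \<gamma>"
      | "underS r \<gamma> \<noteq> {}" "\<nexists>\<beta>. imm_pred r \<beta> \<gamma>" by blast
    then show ?thesis
    proof cases
      case 1
      show ?thesis
        by (rule constant_on_aorb_zero[OF cont inv]) (use v 1 in \<open>simp add: aorb_zero_eq\<close>)
    next
      case (2 \<beta>)
      show ?thesis
      proof (rule constant_on_aorb_succ[OF cont])
        show "v \<in> aorb_succ (sorb \<phi> r \<beta>) u"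
          using v by (simp only: aorb_succ_eq[OF wo 2])
        show "f b = f a" if "b \<in> sorb \<phi> r \<beta> a" for a b
          using 2 by (intro IH[OF _ that]) (simp add: imm_pred_def)
      qed
    next
      case 3
      then obtain \<beta> where "\<beta> \<in> underS r \<gamma>" "v \<in> sorb \<phi> r \<beta> u"
        using v unfolding aorb_limit_eq[OF 3] by blast
      then show ?thesis by (rule IH)
    qed
  qed
  moreover have "y \<in> gen_class (aorb \<phi> r \<gamma>) x"
    using 1(2) unfolding sorb_eq[OF wo] .
  ultimately show ?case
    by (rule constant_on_gen_class[of "aorb \<phi> r \<gamma>" f y x])
qed

section \<open>Superorbits increase and stabilize\<close>

lemma sorb_refl: "Well_order r \<Longrightarrow> x \<in> sorb \<phi> r \<gamma> x"
  by (simp only: sorb_eq gen_class_refl)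

lemma aorb_zero_refl: "x \<in> aorb_zero \<phi> x"
  by (auto simp: aorb_zero_def nbhd_def dest: eventually_nhds_x_imp_x)

lemma aorb_refl:
  assumes wo: "Well_order r"
  shows "x \<in> aorb \<phi> r \<gamma> x"
proof -
  consider "underS r \<gamma> = {}" | \<beta> where "imm_pred r \<beta> \<gamma>"
    | "underS r \<gamma> \<noteq> {}" "\<nexists>\<beta>. imm_pred r \<beta> \<gamma>" by blast
  then show ?thesis
  proof cases
    case 1
    then show ?thesis by (simp add: aorb_zero_eq aorb_zero_refl)
  next
    case (2 \<beta>)
    then show ?thesis
      using subset_aorb_succ[of x "sorb \<phi> r \<beta>", OF sorb_refl[OF wo]] sorb_refl[OF wo, of x \<phi> \<beta>]
      by (auto simp: aorb_succ_eq[OF wo])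
  next
    case 3
    then show ?thesis using sorb_refl[OF wo] by (subst aorb_limit_eq) blast+
  qed
qed

lemma aorb_subset_sorb: "Well_order r \<Longrightarrow> aorb \<phi> r \<gamma> x \<subseteq> sorb \<phi> r \<gamma> x"
  by (simp only: sorb_eq aorb_refl subset_gen_class)

lemma sorb_subset_aorb:
  assumes wo: "Well_order r"
  shows "\<beta> \<in> underS r \<gamma> \<Longrightarrow> sorb \<phi> r \<beta> x \<subseteq> aorb \<phi> r \<gamma> x"
proof (induction \<gamma> rule: wf_induct_rule[OF Well_order_imp_wf[OF wo]])
  case (1 \<gamma>)
  show ?case
  proof (cases "\<exists>\<delta>. imm_pred r \<delta> \<gamma>")
    case True
    then obtain \<delta> where \<delta>: "imm_pred r \<delta> \<gamma>" by blast
    then have "\<beta> = \<delta> \<or> \<beta> \<in> underS r \<delta>"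
      using 1(2) by (auto simp: imm_pred_def under_def underS_def)
    then have "sorb \<phi> r \<beta> x \<subseteq> sorb \<phi> r \<delta> x"
      using 1(1)[of \<delta>] \<delta> aorb_subset_sorb[OF wo, of \<phi> \<delta> x]
      by (auto simp: imm_pred_def underS_iff)
    also have "\<dots> \<subseteq> aorb \<phi> r \<gamma> x"
      by (simp add: aorb_succ_eq[OF wo \<delta>] subset_aorb_succ sorb_refl[OF wo])
    finally show ?thesis .
  next
    case False
    then show ?thesis using 1(2) by (subst aorb_limit_eq) auto
  qed
qed

lemma sorb_mono:
  assumes "Well_order r" "(\<beta>, \<gamma>) \<in> r"
  shows "sorb \<phi> r \<beta> x \<subseteq> sorb \<phi> r \<gamma> x"
  using sorb_subset_aorb[OF assms(1), of \<beta> \<gamma> \<phi> x] aorb_subset_sorb[OF assms(1), of \<phi> \<gamma> x] assms(2)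
  by (cases "\<beta> = \<gamma>") (auto simp: underS_iff)

lemma ex_successor:
  assumes wo: "Well_order r" and \<beta>: "\<beta> \<in> underS r \<delta>"
  obtains \<sigma> where "imm_pred r \<beta> \<sigma>" "(\<sigma>, \<delta>) \<in> r"
proof -
  have ord: "wf (r - Id)" "Total r" "Refl r"
    using wo by (auto simp: order_on_defs)
  have comparable: "a \<in> underS r b \<or> (b, a) \<in> r" if "a \<in> Field r" "b \<in> Field r" for a b
    using that ord(2,3) by (cases "a = b") (auto simp: underS_def total_on_def refl_on_def)
  obtain \<sigma> where \<sigma>: "\<beta> \<in> underS r \<sigma>"
    and least: "\<And>\<tau>. (\<tau>, \<sigma>) \<in> r - Id \<Longrightarrow> \<beta> \<notin> underS r \<tau>"
    using wfE_min[OF ord(1), of \<delta> "{\<sigma>. \<beta> \<in> underS r \<sigma>}"] \<beta> by auto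
  have fld: "\<beta> \<in> Field r" "\<sigma> \<in> Field r" "\<delta> \<in> Field r"
    using \<sigma> \<beta> by (auto simp: underS_def Field_def)
  have "imm_pred r \<beta> \<sigma>"
    using \<sigma> least comparable[OF fld(1)] by (auto simp: imm_pred_def underS_def under_def Field_def)
  moreover have "(\<sigma>, \<delta>) \<in> r"
    using comparable[OF fld(3,2)] least[of \<delta>] \<beta> by (auto simp: underS_iff)
  ultimately show thesis using that by blast
qed

text \<open>
  The sets that define the approximating orbits of the least stage are invariant under \<open>\<phi>\<close>, and
  all later superorbits are larger. This is how \<open>\<phi>\<close> enters every stage.
\<close>
lemma image_in_sorb:
  assumes wo: "Well_order r" and \<gamma>: "\<gamma> \<in> Field r"
  shows "\<phi> x \<in> sorb \<phi> r \<gamma> x"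
proof -
  have ord: "wf (r - Id)" "Total r" "Refl r"
    using wo by (auto simp: order_on_defs)
  \<comment> \<open>\<open>z\<close> is the least element of the well-order and represents the ordinal \<open>0\<close>.\<close>
  obtain z where z: "z \<in> Field r" and least: "\<And>\<tau>. (\<tau>, z) \<in> r - Id \<Longrightarrow> \<tau> \<notin> Field r"
    using wfE_min[OF ord(1) \<gamma>] by blast
  have "underS r z = {}"
    using least by (auto simp: underS_def Field_def)
  then have "aorb \<phi> r z = aorb_zero \<phi>"
    by (rule aorb_zero_eq)
  moreover have "\<phi> x \<in> aorb_zero \<phi> x"
    by (auto simp: aorb_zero_def nbhd_def dest: eventually_nhds_x_imp_x)
  ultimately have "\<phi> x \<in> sorb \<phi> r z x"
    using aorb_subset_sorb[OF wo, of \<phi> z x] by auto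
  moreover have "(z, \<gamma>) \<in> r"
    using z \<gamma> least[of \<gamma>] ord(2,3) by (cases "z = \<gamma>") (auto simp: total_on_def refl_on_def)
  ultimately show ?thesis
    using sorb_mono[OF wo] by blast
qed

text \<open>
  By Cantor's theorem a well-order on the sets of relations on \<open>K\<close> is too long for its stages
  to have distinct superorbit relations. If two stages \<open>\<beta> < \<delta>\<close> agree, then so do \<open>\<beta>\<close>
  and its successor, which lies between them.
\<close>
lemma sorb_stabilizes:
  fixes \<phi> :: "'a::topological_space \<Rightarrow> 'a" and r :: "'a rel set rel"
  assumes wo: "Well_order r" and fld: "Field r = UNIV"
  obtains \<gamma> where "\<forall>x. aorb_succ (sorb \<phi> r \<gamma>) x \<subseteq> sorb \<phi> r \<gamma> x"
proof -
  define h :: "'a rel set \<Rightarrow> 'a rel" where "h \<gamma> = {(x, y). y \<in> sorb \<phi> r \<gamma> x}" for \<gamma>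
  have "\<not> inj h"
  proof
    assume "inj h"
    then have "range (inv h) = Pow (UNIV :: 'a rel set)"
      by (simp add: inj_imp_surj_inv)
    then show False using Cantors_theorem by blast
  qed
  then obtain a b where ab: "a \<noteq> b" "h a = h b"
    unfolding inj_def by blast
  have "Total r"
    using wo by (simp add: order_on_defs)
  then have "a \<in> underS r b \<or> b \<in> underS r a"
    using ab(1) fld by (simp add: total_on_def underS_def)
  then obtain \<beta> \<delta> where \<beta>: "\<beta> \<in> underS r \<delta>" and eq: "h \<beta> = h \<delta>"
    using ab(2) by metis
  obtain \<sigma> where \<sigma>: "imm_pred r \<beta> \<sigma>" "(\<sigma>, \<delta>) \<in> r"
    using ex_successor[OF wo \<beta>] .
  have "aorb_succ (sorb \<phi> r \<beta>) x \<subseteq> sorb \<phi> r \<beta> x" for x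
  proof -
    have "aorb_succ (sorb \<phi> r \<beta>) x \<subseteq> sorb \<phi> r \<sigma> x"
      using aorb_subset_sorb[OF wo, of \<phi> \<sigma> x] by (simp add: aorb_succ_eq[OF wo \<sigma>(1)])
    also have "\<dots> \<subseteq> sorb \<phi> r \<delta> x"
      by (rule sorb_mono[OF wo \<sigma>(2)])
    also have "\<dots> = sorb \<phi> r \<beta> x"
      using eq by (auto simp: h_def)
    finally show ?thesis .
  qed
  then show thesis
    by (intro that allI)
qed

section \<open>Continuous functions on the quotient by a stable relation\<close>

text \<open>
  If the successor step does not enlarge the class of \<open>x\<close>, then a point \<open>y\<close> outside is excluded by
  some saturated open \<open>U\<close> around \<open>x\<close> and some saturated closed \<open>F\<close> containing \<open>U\<close>. The
  complement of \<open>F\<close> is then a saturated open neighbourhood of \<open>y\<close>.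
\<close>
lemma stable_class_separated:
  assumes S: "\<And>u v. v \<in> S u \<longleftrightarrow> S v = S u" and stable: "aorb_succ S x \<subseteq> S x"
    and ne: "S x \<noteq> S y"
  shows "\<exists>U V. open U \<and> open V \<and> x \<in> U \<and> y \<in> V \<and> U \<inter> V = {} \<and>
    S -` S ` U = U \<and> S -` S ` V = V"
proof -
  have "y \<notin> aorb_succ S x"
    using ne S stable by blast
  then obtain U F where U: "nbhd U x" "open U" "(\<Union>u\<in>U. S u) \<subseteq> U"
    and F: "closed F" "U \<subseteq> F" "(\<Union>u\<in>F. S u) \<subseteq> F" and y: "y \<notin> F"
    by (auto simp: aorb_succ_def sat_closure_def)
  \<comment> \<open>Saturation in the sense of the successor step is rewritten in terms of the class map \<open>S\<close>.\<close>
  have saturated: "S -` S ` A = A" if A: "(\<Union>u\<in>A. S u) \<subseteq> A" for A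
  proof (intro equalityI subsetI)
    fix v assume "v \<in> S -` S ` A"
    then obtain u where u: "u \<in> A" "S v = S u" by blast
    then have "v \<in> S u" by (simp only: S)
    then show "v \<in> A" using u(1) A by blast
  qed blast
  have "S -` S ` (- F) = - F"
  proof (intro equalityI subsetI)
    fix v assume "v \<in> S -` S ` (- F)"
    then obtain u where u: "u \<notin> F" "S v = S u" by blast
    have "v \<notin> F"
    proof
      assume "v \<in> F"
      then have "u \<in> S -` S ` F" using u(2) by blast
      then show False using u(1) saturated[OF F(3)] by simp
    qed
    then show "v \<in> - F" by simp
  qed blast
  moreover have "x \<in> U"
    using U(1) by (auto simp: nbhd_def dest: eventually_nhds_x_imp_x)
  moreover have "U \<inter> - F = {}"
    using F(2) by blast
  ultimately show ?thesis
    using U(2) saturated[OF U(3)] F(1) y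
    by - (rule exI[of _ U], rule exI[of _ "- F"], simp add: open_Compl)
qed

text \<open>
  A set \<open>U\<close> is saturated for the kernel of \<open>q\<close> if \<open>q -` q ` U = U\<close>, so the separation hypothesis is
  the Hausdorff property of the quotient of the space by that kernel. That quotient is realized on the range
  of \<open>q\<close>, and Urysohn's lemma is applied there.
\<close>
lemma Urysohn_quotient:
  fixes q :: "'a::topological_space \<Rightarrow> 'b"
  assumes comp: "compact (UNIV :: 'a set)"
    and sep: "\<And>x y. q x \<noteq> q y \<Longrightarrow> \<exists>U V. open U \<and> open V \<and> x \<in> U \<and> y \<in> V \<and> U \<inter> V = {} \<and>
      q -` q ` U = U \<and> q -` q ` V = V"
    and ne: "q x \<noteq> q y"
  obtains g :: "'b \<Rightarrow> real" where "continuous_on UNIV (g \<circ> q)" "g (q x) = 0" "g (q y) = 1"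
proof -
  define Y where "Y = topology (\<lambda>W. W \<subseteq> range q \<and> open (q -` W))"
  have "istopology (\<lambda>W. W \<subseteq> range q \<and> open (q -` W))"
    by (auto simp: istopology_def vimage_Union)
  then have openY: "openin Y W \<longleftrightarrow> W \<subseteq> range q \<and> open (q -` W)" for W
    by (simp add: Y_def)
  have "q -` range q = UNIV"
    by auto
  then have "openin Y (range q)"
    by (simp add: openY)
  then have topY: "topspace Y = range q"
    using openY[of "topspace Y"] openin_subset[of Y "range q"] by auto
  have contq: "continuous_map euclidean Y q"
    by (auto simp: continuous_map_def topY openY vimage_def)
  have "compactin Y (range q)"
    using image_compactin[OF _ contq, of UNIV] comp by simp
  then have "compact_space Y"
    by (simp add: compact_space_def topY)
  moreover have Haus: "Hausdorff_space Y"
    unfolding Hausdorff_space_def topY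
  proof safe
    fix u v assume "q u \<noteq> q v"
    from sep[OF this] obtain U V where UV: "open U" "open V" "u \<in> U" "v \<in> V" "U \<inter> V = {}"
      and vim: "q -` q ` U = U" "q -` q ` V = V"
      by (elim exE conjE) (rule that)
    have "openin Y (q ` U)" "openin Y (q ` V)"
      using UV(1,2) vim by (auto simp: openY)
    moreover have "disjnt (q ` U) (q ` V)"
      using UV(5) vim by (auto simp: disjnt_iff)
    ultimately show "\<exists>U V. openin Y U \<and> openin Y V \<and> q u \<in> U \<and> q v \<in> V \<and> disjnt U V"
      using UV(3,4) by blast
  qed
  ultimately have "normal_space Y"
    using compact_Hausdorff_or_regular_imp_normal_space by blast
  moreover have "closedin Y {q x}" "closedin Y {q y}"
    using Haus by (auto simp: closedin_Hausdorff_sing_eq topY)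
  moreover have "disjnt {q x} {q y}"
    using ne by simp
  ultimately obtain g :: "'b \<Rightarrow> real" where g: "continuous_map Y euclideanreal g"
      "g ` {q x} \<subseteq> {0}" "g ` {q y} \<subseteq> {1}"
    by (rule Urysohn_lemma_alt[where a = 0 and b = 1])
  show thesis
  proof (rule that[of g])
    show "continuous_on UNIV (g \<circ> q)"
      using continuous_map_compose[OF contq g(1)] by simp
  qed (use g in auto)
qed

section \<open>One-dimensional fixed spaces\<close>

lemma dim_fixed_space_eq_1_iff:
  "cfun.dim (fixed_space \<phi>) = 1 \<longleftrightarrow> (\<forall>f\<in>fixed_space \<phi>. \<forall>x y. f x = f y)"
proof -
  let ?one = "\<lambda>_::'a. 1::complex"
  have one: "?one \<in> fixed_space \<phi>"
    by (auto simp: fixed_space_def continuous_functions_def koopman_def)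
  have span_singleton: "cfun.span {b} = range (\<lambda>c x. c * b x)" for b :: "'a \<Rightarrow> complex"
    by (rule cfun.span_singleton)
  show ?thesis
  proof
    assume "cfun.dim (fixed_space \<phi>) = 1"
    then obtain B where B: "fixed_space \<phi> \<subseteq> cfun.span B" "card B = 1"
      by (metis cfun.basis_exists)
    then obtain b where b: "fixed_space \<phi> \<subseteq> range (\<lambda>c x. c * b x)"
      using span_singleton by (metis card_1_singletonE)
    then obtain c where c: "?one = (\<lambda>x. c * b x)"
      using one by blast
    have "b x = b y" for x y
      using fun_cong[OF c, of x] fun_cong[OF c, of y]
      by (metis mult_cancel_left mult_zero_left zero_neq_one)
    then show "\<forall>f\<in>fixed_space \<phi>. \<forall>x y. f x = f y"
      using b by fastforce
  next
    assume const: "\<forall>f\<in>fixed_space \<phi>. \<forall>x y. f x = f y"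
    have "fixed_space \<phi> \<subseteq> cfun.span {?one}"
    proof
      fix f assume "f \<in> fixed_space \<phi>"
      \<comment> \<open>Any point may take the place of \<open>undefined\<close>, as \<open>f\<close> is constant.\<close>
      then have "f = (\<lambda>x. f undefined * ?one x)"
        using const by auto
      then show "f \<in> cfun.span {?one}"
        unfolding span_singleton by blast
    qed
    moreover have "\<not> cfun.dependent {?one}"
      by (simp add: cfun.dependent_single fun_eq_iff)
    ultimately show "cfun.dim (fixed_space \<phi>) = 1"
      using one by (intro cfun.dim_unique[of "{?one}"]) auto
  qed
qed

section \<open>Topological ergodicity\<close>

theorem theorem4p9:
  fixes \<phi> :: "'a::t2_space \<Rightarrow> 'a"
  assumes "compact (UNIV :: 'a set)"
    and "continuous_on UNIV \<phi>"
  shows "cfun.dim (fixed_space \<phi>) = 1 \<longleftrightarrow> topologically_ergodic \<phi>"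
  unfolding dim_fixed_space_eq_1_iff
proof
  assume const: "\<forall>f\<in>fixed_space \<phi>. \<forall>x y. f x = f y"
  obtain r :: "'a rel set rel" where wo: "Well_order r" and fld: "Field r = UNIV"
    using well_ordering[where ?'a = "'a rel set"] by (elim exE conjE)
  obtain \<gamma> where stable: "\<forall>x. aorb_succ (sorb \<phi> r \<gamma>) x \<subseteq> sorb \<phi> r \<gamma> x"
    using sorb_stabilizes[OF wo fld] .
  define S where "S = sorb \<phi> r \<gamma>"
  have class_iff: "v \<in> S u \<longleftrightarrow> S v = S u" for u v
    unfolding S_def sorb_eq[OF wo] by (rule in_gen_class_iff)
  have S_\<phi>: "S (\<phi> u) = S u" for u
    using image_in_sorb[OF wo, of \<gamma> \<phi> u] fld class_iff by (simp add: S_def)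
  have "S x = S y" for x y
  proof (rule ccontr)
    assume ne: "S x \<noteq> S y"
    obtain g :: "'a set \<Rightarrow> real"
      where g: "continuous_on UNIV (g \<circ> S)" "g (S x) = 0" "g (S y) = 1"
      by (rule Urysohn_quotient[OF assms(1) stable_class_separated[OF class_iff] ne])
        (simp add: S_def stable)
    have "(\<lambda>u. complex_of_real (g (S u))) \<in> fixed_space \<phi>"
      using g(1) S_\<phi>
      by (auto simp: fixed_space_def continuous_functions_def koopman_def fun_eq_iff comp_def
          intro!: continuous_intros)
    then show False
      using const g(2,3) by (metis of_real_eq_iff zero_neq_one)
  qed
  then have "sorb \<phi> r \<gamma> x = UNIV" for x
    using class_iff S_def by blast
  then show "topologically_ergodic \<phi>"
    using topologically_ergodicI[OF wo] fld by blast
next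
  assume "topologically_ergodic \<phi>"
  then obtain r :: "'a rel rel" and \<gamma> z where wo: "Well_order r" and z: "sorb \<phi> r \<gamma> z = UNIV"
    by (auto simp: topologically_ergodic_def)
  show "\<forall>f\<in>fixed_space \<phi>. \<forall>x y. f x = f y"
  proof (intro ballI allI)
    fix f x y assume "f \<in> fixed_space \<phi>"
    then have "f w = f z" for w
      using invariant_constant_on_sorb[OF wo, of f \<phi> w \<gamma> z] z
      by (simp add: fixed_space_def continuous_functions_def koopman_def)
    then show "f x = f y" by metis
  qed
qed

end
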